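(* Each component of a weighted Toeplitz graph is isomorphic to a weighted Toeplitz graph under the normalized labeling of its vertex set.
   Context: For real numbers $a_0,\ldots,a_{n-1}$, $T[a_0,\ldots,a_{n-1}]$ denotes the $n\times n$ symmetric Toeplitz matrix whose $(i,j)$ entry is $a_{|i-j|}$. For such $A$, $S_A=\{i\in\mathbb{Z}\colon\, 0\le i\le n-1,\ a_i\neq 0\}$ and $w_A(s)=a_s$. The weighted Toeplitz graph $G(A)$ of a symmetric Toeplitz matrix $A$ is the edge-weighted graph with vertex set $\{1,\ldots,n\}$, where $i$ and $j$ are adjacent iff $|i-j|\in S_A$, with edge $ij$ of weight $w_A(|i-j|)$. A component is a maximal connected subgraph. If the vertex set of a component is $n_1<n_2<\cdots<n_k$, its normalized labeling is the relabeling $n_i\mapsto i$ for $i=1,\ldots,k$. Isomorphism is of edge-weighted graphs (preserving adjacency and weights). *)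

theory Defs
  imports
    "Jordan_Normal_Form.Matrix"
    "Graph_Theory.Digraph_Isomorphism"
    "Graph_Theory.Weighted_Graph"
begin

definition toeplitz :: "real list \<Rightarrow> real mat" where
  "toeplitz a = mat (length a) (length a) (\<lambda>(i, j). a ! nat \<bar>int i - int j\<bar>)"

(* For A = toeplitz a the entry a_s is read off the first row, which has index 0. *)

definition toeplitz_support :: "real mat \<Rightarrow> nat set" where
  "toeplitz_support A = {s. s < dim_row A \<and> A $$ (0, s) \<noteq> 0}"

definition toeplitz_coeff :: "real mat \<Rightarrow> nat \<Rightarrow> real" where
  "toeplitz_coeff A s = A $$ (0, s)"

(* As in Graph_Theory, an undirected graph is a symmetric digraph: the edge ij is the pair
   of arcs (i, j), (j, i). There are loops (at every vertex) iff 0 is in the support. *)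

definition toeplitz_graph :: "real mat \<Rightarrow> (nat, nat \<times> nat) pre_digraph" where
  "toeplitz_graph A = with_proj
     \<lparr> pverts = {1..dim_row A},
       parcs = {(i, j). i \<in> {1..dim_row A} \<and> j \<in> {1..dim_row A} \<and>
                        nat \<bar>int i - int j\<bar> \<in> toeplitz_support A} \<rparr>"

definition toeplitz_weight :: "real mat \<Rightarrow> (nat \<times> nat) weight_fun" where
  "toeplitz_weight A = (\<lambda>(i, j). toeplitz_coeff A (nat \<bar>int i - int j\<bar>))"

definition component :: "('a, 'b) pre_digraph \<Rightarrow> ('a, 'b) pre_digraph \<Rightarrow> bool" where
  "component G H \<longleftrightarrow> pre_digraph.max_subgraph G connected H"

(* Only the values of w on the arcs of G and of w' on the arcs of H matter; in particular a
   subgraph carries the weight function of the ambient graph. *)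

definition weighted_isomorphism ::
  "('a, 'b, 'c, 'd) digraph_isomorphism \<Rightarrow> ('a, 'b) pre_digraph \<Rightarrow> 'b weight_fun \<Rightarrow>
   ('c, 'd) pre_digraph \<Rightarrow> 'd weight_fun \<Rightarrow> bool" where
  "weighted_isomorphism \<phi> G w H w' \<longleftrightarrow>
     pre_digraph.digraph_isomorphism G \<phi> \<and> app_iso \<phi> G = H \<and>
     (\<forall>e \<in> arcs G. w' (iso_arcs \<phi> e) = w e)"

definition relabeling ::
  "('a \<Rightarrow> 'c) \<Rightarrow> ('a, 'a \<times> 'a, 'c, 'c \<times> 'c) digraph_isomorphism" where
  "relabeling f = \<lparr> iso_verts = f, iso_arcs = map_prod f f, iso_head = snd, iso_tail = fst \<rparr>"

definition normalized_labeling :: "nat set \<Rightarrow> nat \<Rightarrow> nat" where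
  "normalized_labeling V v = (THE i. i \<in> {1..card V} \<and> sorted_list_of_set V ! (i - 1) = v)"

lemma normalized_labeling_nth:
  assumes "finite V" and "i \<in> {1..card V}"
  shows "normalized_labeling V (sorted_list_of_set V ! (i - 1)) = i"
  unfolding normalized_labeling_def
proof (rule the_equality)
  fix k assume k: "k \<in> {1..card V} \<and> sorted_list_of_set V ! (k - 1) = sorted_list_of_set V ! (i - 1)"
  have "k - 1 < length (sorted_list_of_set V)" "i - 1 < length (sorted_list_of_set V)"
    using assms k by auto
  then have "k - 1 = i - 1"
    using k nth_eq_iff_index_eq distinct_sorted_list_of_set by blast
  then show "k = i" using assms k by auto
qed (use assms in auto)

end

theory Submission
  imports Defs
begin

text \<open>
  Let \<open>C\<close> be the vertex set of a component and \<open>s\<close> an element of the support. Whenever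
  \<open>x\<close> and \<open>x + s\<close> are both vertices of the graph they are adjacent, so one lies in \<open>C\<close> iff the
  other does. Hence sliding a window of length \<open>s\<close> by one position never changes the number of
  elements of \<open>C\<close> inside it: two adjacent vertices of \<open>C\<close> at distance \<open>s\<close> always differ in rank
  by the same amount. Conversely, two elements of \<open>C\<close> with that difference of ranks are at
  distance \<open>s\<close>, so the weight of a pair depends only on the difference of the ranks.
\<close>

section \<open>Ranks in a set closed under a shift\<close>

text \<open>Defined at every natural \<open>v\<close>, not just on \<open>C\<close>, so that
  inductions can advance one integer at a time through the gaps of \<open>C\<close>. On
  \<open>C\<close> it is the position counted from 0.\<close>

definition rank :: "nat set \<Rightarrow> nat \<Rightarrow> nat" where
  "rank C v = card (C \<inter> {..<v})"

lemma rank_Suc: "rank C (Suc v) = rank C v + (if v \<in> C then 1 else 0)"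
proof -
  have "C \<inter> {..<Suc v} = (if v \<in> C then insert v (C \<inter> {..<v}) else C \<inter> {..<v})"
    by (auto simp: less_Suc_eq)
  then show ?thesis by (simp add: rank_def)
qed

lemma rank_mono: "u \<le> v \<Longrightarrow> rank C u \<le> rank C v"
  unfolding rank_def by (rule card_mono) auto

lemma rank_less: "u \<in> C \<Longrightarrow> u < v \<Longrightarrow> rank C u < rank C v"
  using rank_mono[of "Suc u" v C] by (simp add: rank_Suc)

lemma rank_eq_iff: "u \<in> C \<Longrightarrow> v \<in> C \<Longrightarrow> rank C u = rank C v \<longleftrightarrow> u = v"
  using rank_less[of u C v] rank_less[of v C u] by (cases u v rule: linorder_cases) auto

lemma rank_le_iff: "u \<in> C \<Longrightarrow> v \<in> C \<Longrightarrow> rank C u \<le> rank C v \<longleftrightarrow> u \<le> v"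
  using rank_less[of v C u] rank_mono[of u v C] by (cases "u \<le> v") auto

text \<open>The list is strictly increasing, so the elements of \<open>C\<close> below its entry
  \<open>k\<close> are exactly the entries at \<open>0, ..., k - 1\<close>.\<close>

lemma rank_nth_sorted_list_of_set:
  assumes "finite C" and "k < card C"
  shows "rank C (sorted_list_of_set C ! k) = k"
proof -
  let ?xs = "sorted_list_of_set C"
  have sorted: "sorted_wrt (<) ?xs" by simp
  have less: "?xs ! i < ?xs ! k \<longleftrightarrow> i < k" if "i < card C" for i
    using sorted_wrt_nth_less[OF sorted, of i k] sorted_wrt_nth_less[OF sorted, of k i] assms that
    by (cases i k rule: linorder_cases) auto
  have "C = (!) ?xs ` {..<card C}"
    using assms nth_image[of "length ?xs" ?xs] by (simp add: lessThan_atLeast0)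
  then have "C \<inter> {..<?xs ! k} = (!) ?xs ` {i. i < card C \<and> ?xs ! i < ?xs ! k}"
    by (subst \<open>C = _\<close>) auto
  also have "{i. i < card C \<and> ?xs ! i < ?xs ! k} = {..<k}"
    using less assms by auto
  finally have "C \<inter> {..<?xs ! k} = (!) ?xs ` {..<k}" .
  moreover have "inj_on ((!) ?xs) {..<k}"
    using assms by (intro inj_on_nth) auto
  ultimately show ?thesis
    by (simp add: rank_def card_image)
qed

lemma nth_sorted_list_of_set_in:
  "finite C \<Longrightarrow> k < card C \<Longrightarrow> sorted_list_of_set C ! k \<in> C"
  by (metis length_sorted_list_of_set nth_mem set_sorted_list_of_set)

lemma rank_less_card: "finite C \<Longrightarrow> v \<in> C \<Longrightarrow> rank C v < card C"
  unfolding rank_def by (rule psubset_card_mono) auto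

lemma nth_sorted_list_of_set_rank:
  assumes "finite C" and "v \<in> C"
  shows "sorted_list_of_set C ! rank C v = v"
proof -
  have "rank C v < card C" using assms by (rule rank_less_card)
  then show ?thesis
    using assms rank_eq_iff rank_nth_sorted_list_of_set nth_sorted_list_of_set_in by metis
qed

text \<open>Labels start at 1 and ranks at 0; the shift cancels in differences, so label distances
  are rank distances.\<close>

lemma normalized_labeling_eq_rank:
  assumes "finite C" and "v \<in> C"
  shows "normalized_labeling C v = Suc (rank C v)"
  using normalized_labeling_nth[of C "Suc (rank C v)"] rank_less_card[OF assms] assms
  by (simp add: nth_sorted_list_of_set_rank)

lemma normalized_labeling_image:
  assumes "finite C"
  shows "normalized_labeling C ` C = {1..card C}"
proof
  show "normalized_labeling C ` C \<subseteq> {1..card C}"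
    using assms by (auto simp: normalized_labeling_eq_rank Suc_le_eq rank_less_card)
  show "{1..card C} \<subseteq> normalized_labeling C ` C"
  proof
    fix i assume i: "i \<in> {1..card C}"
    then have "sorted_list_of_set C ! (i - 1) \<in> C"
      using assms by (intro nth_sorted_list_of_set_in) auto
    then show "i \<in> normalized_labeling C ` C"
      using normalized_labeling_nth[OF assms i] by (metis imageI)
  qed
qed

text \<open>Replacing \<open>x\<close> by \<open>x + 1\<close> adds 1 to both sides or to neither,
  because \<open>x\<close> and \<open>x + s\<close> lie in \<open>C\<close> together. Thus every
  window of length \<open>s\<close> holds as many elements of \<open>C\<close> as the first one,
  \<open>{1..s}\<close>.\<close>

lemma rank_add:
  assumes sub: "C \<subseteq> {1..}"
    and closed: "\<And>x. 1 \<le> x \<Longrightarrow> x + s \<le> n \<Longrightarrow> x \<in> C \<longleftrightarrow> x + s \<in> C"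
    and "1 \<le> x" and "x + s \<le> n"
  shows "rank C (x + s) = rank C x + rank C (1 + s)"
  using \<open>1 \<le> x\<close> \<open>x + s \<le> n\<close>
proof (induction x rule: dec_induct)
  case base
  \<comment> \<open>Vertices start at 1, so \<open>rank C 1 = 0\<close>.\<close>
  have "C \<inter> {..<1} = {}" using sub by auto
  then show ?case by (simp add: rank_def)
next
  case (step x)
  then show ?case using closed[of x] by (simp add: rank_Suc)
qed

text \<open>Closure is assumed only for the shift \<open>v - u\<close>; nothing is known in advance
  about the distance from \<open>u'\<close> to \<open>v'\<close>. The pair is compared with a
  shifted copy of one of its members, which \<open>rank\<close> identifies with the other.\<close>

lemma rank_diff_determines_diff:
  assumes sub: "C \<subseteq> {1..n}"
    and closed: "\<And>x. 1 \<le> x \<Longrightarrow> x + (v - u) \<le> n \<Longrightarrow> x \<in> C \<longleftrightarrow> x + (v - u) \<in> C"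
    and mem: "u \<in> C" "v \<in> C" "u' \<in> C" "v' \<in> C" and "u \<le> v" "u' \<le> v'"
    and rank: "rank C v - rank C u = rank C v' - rank C u'"
  shows "v - u = v' - u'"
proof -
  define s where "s = v - u"
  have C: "C \<subseteq> {1..}" using sub by auto
  have add: "rank C (x + s) = rank C x + rank C (1 + s)" if "1 \<le> x" "x + s \<le> n" for x
    using rank_add[OF C closed that[unfolded s_def]] by (simp add: s_def)
  have "rank C v = rank C u + rank C (1 + s)"
    using add[of u] subsetD[OF sub \<open>u \<in> C\<close>] subsetD[OF sub \<open>v \<in> C\<close>] \<open>u \<le> v\<close>
    by (simp add: s_def)
  then have v': "rank C v' = rank C u' + rank C (1 + s)"
    using rank rank_mono[OF \<open>u' \<le> v'\<close>, of C] by simp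
  \<comment> \<open>If \<open>u' + s\<close> is a vertex, it lies in \<open>C\<close> and has the
    rank of \<open>v'\<close>; if \<open>v' - s\<close> is a vertex, it lies in \<open>C\<close> and
    has the rank of \<open>u'\<close>. Otherwise \<open>v'\<close> is among the first
    \<open>s\<close> vertices, and its rank is too small.\<close>
  consider "u' + s \<le> n" | "s < v'" | "v' \<le> s" by linarith
  then have "v' = u' + s"
  proof cases
    case 1
    have "1 \<le> u'" using mem C by auto
    with 1 have "u' + s \<in> C" using closed[of u'] mem by (simp add: s_def)
    then show ?thesis using add[OF \<open>1 \<le> u'\<close> 1] v' mem rank_eq_iff by metis
  next
    case 2
    then have le: "1 \<le> v' - s" "v' - s + s \<le> n" using mem sub by auto
    then have "v' - s \<in> C" using closed[of "v' - s"] mem 2 by (simp add: s_def)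
    moreover have "rank C (v' - s) = rank C u'" using add[OF le] v' 2 by simp
    ultimately have "v' - s = u'" using mem rank_eq_iff by metis
    then show ?thesis using 2 by simp
  next
    case 3
    then have "rank C v' < rank C (1 + s)" using mem by (intro rank_less) auto
    then show ?thesis using v' by simp
  qed
  then show ?thesis by (simp add: s_def)
qed

section \<open>Components\<close>

text \<open>Adjoining \<open>e\<close> and its ends to \<open>H\<close> keeps it connected, so
  maximality forces the enlarged graph to be \<open>H\<close>. Hence a component is induced, and no
  arc leaves it.\<close>

lemma (in wf_digraph) max_connected_subgraph_arcs:
  assumes max: "max_subgraph connected H"
    and e: "e \<in> arcs G" and end_in: "tail G e \<in> verts H \<or> head G e \<in> verts H"
  shows "e \<in> arcs H"
proof -
  define H' where "H' = \<lparr> verts = insert (tail G e) (insert (head G e) (verts H)),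
    arcs = insert e (arcs H), tail = tail G, head = head G \<rparr>"
  have sub: "subgraph H G" and conn: "connected H"
    using max by (auto simp: max_subgraph_def)
  have compat: "tail H = tail G" "head H = head G"
    using sub by (auto simp: subgraph_def compatible_def)
  interpret H: wf_digraph H using sub by auto
  have wf': "wf_digraph H'"
    using H.tail_in_verts H.head_in_verts compat by unfold_locales (auto simp: H'_def)
  have HH': "subgraph H H'"
    using wf' H.wf_digraph_axioms compat by (auto simp: subgraph_def compatible_def H'_def)
  have H'G: "subgraph H' G"
    using wf' wf_digraph_axioms sub e tail_in_verts[OF e] head_in_verts[OF e]
    by (auto simp: subgraph_def compatible_def H'_def)
  interpret M: pair_wf_digraph "mk_symmetric H'"
    using wf' by (rule wf_digraph.wellformed_mk_symmetric)
  \<comment> \<open>An end of \<open>e\<close> in \<open>H\<close> serves as a hub: every vertex of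
    \<open>H'\<close> is joined to it in both directions, within \<open>H\<close> or along
    \<open>e\<close>, since \<open>mk_symmetric\<close> supplies reverse arcs.\<close>
  obtain y where y: "y \<in> {tail G e, head G e}" "y \<in> verts H" using end_in by auto
  have "u \<rightarrow>\<^sup>*\<^bsub>mk_symmetric H'\<^esub> y \<and> y \<rightarrow>\<^sup>*\<^bsub>mk_symmetric H'\<^esub> u" if u: "u \<in> verts H'" for u
  proof (cases "u \<in> verts H")
    case True
    then have "u \<rightarrow>\<^sup>*\<^bsub>mk_symmetric H\<^esub> y" "y \<rightarrow>\<^sup>*\<^bsub>mk_symmetric H\<^esub> u"
      using conn y by (auto simp: connected_def strongly_connected_def)
    then show ?thesis
      using pre_digraph.reachable_mono[OF _ subgraph_mk_symmetric[OF HH']] by blast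
  next
    case False
    then have "(u, y) \<in> parcs (mk_symmetric H')" "(y, u) \<in> parcs (mk_symmetric H')"
      using u y by (auto simp: H'_def parcs_mk_symmetric)
    then show ?thesis by auto
  qed
  then have "u \<rightarrow>\<^sup>*\<^bsub>mk_symmetric H'\<^esub> v" if "u \<in> verts H'" "v \<in> verts H'" for u v
    using that M.reachable_trans by blast
  moreover have "verts H' \<noteq> {}" by (simp add: H'_def)
  ultimately have "connected H'"
    by (simp add: connected_def strongly_connected_def)
  then have "H' = H" using max HH' H'G by (auto simp: max_subgraph_def)
  moreover have "e \<in> arcs H'" by (simp add: H'_def)
  ultimately show ?thesis by simp
qed

section \<open>Toeplitz graphs\<close>

lemma dim_row_toeplitz [simp]: "dim_row (toeplitz a) = length a"
  by (simp add: toeplitz_def)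

lemma toeplitz_coeff_toeplitz: "s < length a \<Longrightarrow> toeplitz_coeff (toeplitz a) s = a ! s"
  unfolding toeplitz_coeff_def toeplitz_def by (subst index_mat) auto

lemma verts_toeplitz_graph [simp]: "verts (toeplitz_graph (toeplitz a)) = {1..length a}"
  by (simp add: toeplitz_graph_def)

lemma arcs_toeplitz_graph:
  "arcs (toeplitz_graph (toeplitz a)) =
    {(i, j). i \<in> {1..length a} \<and> j \<in> {1..length a} \<and> a ! nat \<bar>int i - int j\<bar> \<noteq> 0}"
proof -
  have "toeplitz_support (toeplitz a) = {s. s < length a \<and> a ! s \<noteq> 0}"
    using toeplitz_coeff_toeplitz[of _ a]
    by (auto simp: toeplitz_support_def toeplitz_coeff_def)
  moreover have "nat \<bar>int i - int j\<bar> < length a" if "i \<in> {1..length a}" "j \<in> {1..length a}" for i j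
    using that by auto
  ultimately show ?thesis
    unfolding toeplitz_graph_def dim_row_toeplitz with_proj_simps pair_pre_digraph.simps mem_Collect_eq
    by blast
qed

lemma tail_toeplitz_graph [simp]: "tail (toeplitz_graph A) = fst"
  and head_toeplitz_graph [simp]: "head (toeplitz_graph A) = snd"
  by (simp_all add: toeplitz_graph_def)

lemma wf_toeplitz_graph: "wf_digraph (toeplitz_graph (toeplitz a))"
  by unfold_locales (auto simp: arcs_toeplitz_graph)

theorem theorem3p2:
  fixes a :: "real list" and H :: "(nat, nat \<times> nat) pre_digraph"
  assumes "component (toeplitz_graph (toeplitz a)) H"
  shows "\<exists>b :: real list.
    weighted_isomorphism (relabeling (normalized_labeling (verts H)))
      H (toeplitz_weight (toeplitz a))
      (toeplitz_graph (toeplitz b)) (toeplitz_weight (toeplitz b))"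
proof -
  define G C n f where "G = toeplitz_graph (toeplitz a)" and "C = verts H"
    and "n = length a" and "f = normalized_labeling C"
  interpret G: wf_digraph G unfolding G_def by (rule wf_toeplitz_graph)
  have max: "G.max_subgraph connected H" using assms by (simp add: component_def G_def)
  then have sub: "subgraph H G" by (simp add: G.max_subgraph_def)
  interpret H: wf_digraph H using sub by auto
  have ends: "tail H = fst" "head H = snd"
    using sub by (auto simp: subgraph_def compatible_def G_def)
  have Cn: "C \<subseteq> {1..n}" using sub by (auto simp: subgraph_def C_def n_def G_def)
  then have fin: "finite C" by (rule finite_subset) simp
  have arcs_G: "(i, j) \<in> arcs G \<longleftrightarrow> i \<in> {1..n} \<and> j \<in> {1..n} \<and> a ! nat \<bar>int i - int j\<bar> \<noteq> 0"
    for i j by (auto simp: G_def arcs_toeplitz_graph n_def)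
  have arcs_HI: "(i, j) \<in> arcs H" if "(i, j) \<in> arcs G" "i \<in> C \<or> j \<in> C" for i j
    using G.max_connected_subgraph_arcs[OF max that(1)] that(2) by (simp add: C_def G_def)
  have arcs_HD: "i \<in> C \<and> j \<in> C" if "(i, j) \<in> arcs H" for i j
    using H.tail_in_verts[OF that] H.head_in_verts[OF that] by (simp add: ends C_def)
  have arcs_H: "arcs H = {(i, j). i \<in> C \<and> j \<in> C \<and> a ! nat \<bar>int i - int j\<bar> \<noteq> 0}"
  proof -
    have "arcs H \<subseteq> arcs G" using sub by auto
    then have "(i, j) \<in> arcs H \<longleftrightarrow> i \<in> C \<and> j \<in> C \<and> (i, j) \<in> arcs G" for i j
      using arcs_HI arcs_HD by blast
    moreover have "i \<in> {1..n}" if "i \<in> C" for i using that Cn by blast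
    ultimately show ?thesis by (auto simp: arcs_G)
  qed
  \<comment> \<open>For \<open>s\<close> in the support, the arc from \<open>x\<close> to
    \<open>x + s\<close> has both ends in \<open>C\<close> as soon as it has one.\<close>
  have closed: "x \<in> C \<longleftrightarrow> x + s \<in> C" if "a ! s \<noteq> 0" "1 \<le> x" "x + s \<le> n" for x s
  proof -
    have "(x, x + s) \<in> arcs G" using that by (simp add: arcs_G)
    then show ?thesis using arcs_HI arcs_HD by blast
  qed
  have same: "a ! (v - u) = a ! (v' - u')"
    if "u \<in> C" "v \<in> C" "u' \<in> C" "v' \<in> C" "u \<le> v" "u' \<le> v'"
      and "rank C v - rank C u = rank C v' - rank C u'" for u v u' v'
  proof -
    \<comment> \<open>Only a nonzero coefficient gives closure under the shift. Either pair may
      supply it, with the roles exchanged in the second case; if both coefficients vanish they agree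
      anyway.\<close>
    consider "a ! (v - u) \<noteq> 0" | "a ! (v' - u') \<noteq> 0" | "a ! (v - u) = a ! (v' - u')"
      by fastforce
    then show ?thesis
    proof cases
      case 1
      have "v - u = v' - u'" by (rule rank_diff_determines_diff[OF Cn closed[OF 1] that])
      then show ?thesis by simp
    next
      case 2
      have "v' - u' = v - u"
        by (rule rank_diff_determines_diff[OF Cn closed[OF 2] that(3,4,1,2,6,5) that(7)[symmetric]])
      then show ?thesis by simp
    qed
  qed
  define xs where "xs = sorted_list_of_set C"
  \<comment> \<open>The coefficient at \<open>d\<close> is read off one pair of rank difference
    \<open>d\<close>: the least vertex, of rank 0, and the vertex of rank \<open>d\<close>. By
    \<open>same\<close>, any other such pair gives the same value.\<close>
  define b where "b = map (\<lambda>d. a ! (xs ! d - xs ! 0)) [0..<card C]"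
  have len: "length b = card C" by (simp add: b_def)
  have b_le: "b ! (rank C v - rank C u) = a ! (v - u)" if "u \<in> C" "v \<in> C" "u \<le> v" for u v
  proof -
    define d where "d = rank C v - rank C u"
    have d: "d < card C" using rank_less_card[OF fin \<open>v \<in> C\<close>] by (simp add: d_def)
    then have "0 < card C" by simp
    note mem = nth_sorted_list_of_set_in[OF fin, folded xs_def]
      and rnk = rank_nth_sorted_list_of_set[OF fin, folded xs_def]
    have "xs ! 0 \<le> xs ! d"
      using rank_le_iff[OF mem mem] rnk d \<open>0 < card C\<close> by (metis le0)
    then have "a ! (v - u) = a ! (xs ! d - xs ! 0)"
      using that mem rnk d \<open>0 < card C\<close> by (intro same) (auto simp: d_def)
    then show ?thesis using d by (simp add: b_def d_def)
  qed
  have b_nth: "b ! nat \<bar>int (f u) - int (f v)\<bar> = a ! nat \<bar>int u - int v\<bar>"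
    if "u \<in> C" "v \<in> C" for u v
  proof -
    have *: "nat \<bar>int p - int q\<bar> = (if p \<le> q then q - p else p - q)" for p q by auto
    show ?thesis
      using b_le[OF that] b_le[OF that(2,1)] rank_le_iff[OF that] that fin
      by (simp add: * f_def normalized_labeling_eq_rank)
  qed
  have f_image: "f ` C = {1..card C}" unfolding f_def using fin by (rule normalized_labeling_image)
  have f_inj: "inj_on f C"
    using fin by (intro inj_onI) (simp add: f_def normalized_labeling_eq_rank rank_eq_iff)
  let ?\<phi> = "relabeling f"
  have iso: "H.digraph_isomorphism ?\<phi>"
  proof -
    have "inj_on (map_prod f f) (arcs H)"
      using map_prod_inj_on[OF f_inj f_inj] by (rule inj_on_subset) (auto simp: arcs_H)
    then show ?thesis
      using f_inj H.wf_digraph_axioms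
      by (auto simp: H.digraph_isomorphism_def relabeling_def ends C_def)
  qed
  have app: "app_iso ?\<phi> H = toeplitz_graph (toeplitz b)"
  proof (rule pre_digraph.equality)
    show "verts (app_iso ?\<phi> H) = verts (toeplitz_graph (toeplitz b))"
      using f_image by (simp add: relabeling_def len C_def)
    have "map_prod f f ` arcs H = {(i, j). i \<in> f ` C \<and> j \<in> f ` C \<and> b ! nat \<bar>int i - int j\<bar> \<noteq> 0}"
    proof (intro equalityI subrelI)
      fix i j assume "(i, j) \<in> map_prod f f ` arcs H"
      then obtain u v where "(u, v) \<in> arcs H" "i = f u" "j = f v" by auto
      then show "(i, j) \<in> {(i, j). i \<in> f ` C \<and> j \<in> f ` C \<and> b ! nat \<bar>int i - int j\<bar> \<noteq> 0}"
        by (simp add: arcs_H b_nth)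
    next
      fix i j assume "(i, j) \<in> {(i, j). i \<in> f ` C \<and> j \<in> f ` C \<and> b ! nat \<bar>int i - int j\<bar> \<noteq> 0}"
      then obtain u v where uv: "i = f u" "j = f v" "u \<in> C" "v \<in> C"
        and "b ! nat \<bar>int i - int j\<bar> \<noteq> 0" by auto
      then have "(u, v) \<in> arcs H" by (simp add: arcs_H b_nth)
      then show "(i, j) \<in> map_prod f f ` arcs H" using uv by (auto intro: rev_image_eqI)
    qed
    then show "arcs (app_iso ?\<phi> H) = arcs (toeplitz_graph (toeplitz b))"
      by (simp add: relabeling_def arcs_toeplitz_graph len f_image)
  qed (simp_all add: relabeling_def)
  have weight: "toeplitz_weight (toeplitz b) (iso_arcs ?\<phi> e) = toeplitz_weight (toeplitz a) e"
    if "e \<in> arcs H" for e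
  proof -
    obtain u v where e: "e = (u, v)" "u \<in> C" "v \<in> C" using \<open>e \<in> arcs H\<close> by (auto simp: arcs_H)
    \<comment> \<open>Weights are matrix entries, which equal the list entries only for indices in
      range; arcs of \<open>H\<close> guarantee this on both sides.\<close>
    then have "f u \<in> {1..card C}" "f v \<in> {1..card C}" "u \<in> {1..n}" "v \<in> {1..n}"
      using f_image Cn by blast+
    then have "nat \<bar>int (f u) - int (f v)\<bar> < length b" "nat \<bar>int u - int v\<bar> < length a"
      by (auto simp: len n_def)
    then show ?thesis
      using e b_nth by (simp add: toeplitz_weight_def relabeling_def toeplitz_coeff_toeplitz)
  qed
  show ?thesis
    using iso app weight unfolding weighted_isomorphism_def f_def C_def by blast
qed

end
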